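(* For any non-empty permutations $\alpha$ and $\beta$, the permutation $\alpha\oplus1\oplus\beta$ is an annihilator.
   Context: Permutations are ordered by classical pattern containment ($\sigma\le\pi$ if $\pi$ has a subsequence order-isomorphic to $\sigma$), and $\mu[\sigma,\pi]$ is the Möbius function of this poset: $\mu[\sigma,\sigma]=1$, $\mu[\sigma,\pi]=0$ if $\sigma\not\le\pi$, and $\mu[\sigma,\pi]=-\sum_{\sigma\le\lambda<\pi}\mu[\sigma,\lambda]$ if $\sigma<\pi$. Here $1$ is the permutation of length one. The direct sum of $\alpha$ (length $m$) and $\beta$ (length $n$) is $\alpha\oplus\beta=\alpha_1,\dots,\alpha_m,\beta_1+m,\dots,\beta_n+m$. A permutation $\pi$ has an interval copy of $\phi$ if there is a contiguous block of $|\phi|$ positions of $\pi$ whose values form a contiguous set of integers and whose entries are order-isomorphic to $\phi$. A permutation $\phi$ is an annihilator if every permutation $\pi$ that has an interval copy of $\phi$ satisfies $\mu[1,\pi]=0$. *)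

theory Defs
  imports Main "HOL-Library.Sublist"
begin

text \<open>Permutations of \<open>{1..n}\<close> are lists in one-line notation (\<open>xs ! i\<close> is the image of
  \<open>i + 1\<close>). The empty list is the permutation of length 0.\<close>

definition is_perm :: "nat list \<Rightarrow> bool" where
  "is_perm xs \<longleftrightarrow> distinct xs \<and> set xs = {1..length xs}"

definition order_iso :: "nat list \<Rightarrow> nat list \<Rightarrow> bool" where
  "order_iso xs ys \<longleftrightarrow> length xs = length ys \<and>
     (\<forall>i<length xs. \<forall>j<length xs. xs ! i < xs ! j \<longleftrightarrow> ys ! i < ys ! j)"

definition pattern_le :: "nat list \<Rightarrow> nat list \<Rightarrow> bool" where
  "pattern_le \<sigma> \<pi> \<longleftrightarrow> (\<exists>zs. subseq zs \<pi> \<and> order_iso zs \<sigma>)"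

definition pattern_less :: "nat list \<Rightarrow> nat list \<Rightarrow> bool" where
  "pattern_less \<sigma> \<pi> \<longleftrightarrow> pattern_le \<sigma> \<pi> \<and> \<sigma> \<noteq> \<pi>"

lemma order_iso_refl: "order_iso xs xs"
  by (simp add: order_iso_def)

lemma pattern_le_refl: "pattern_le \<pi> \<pi>"
  unfolding pattern_le_def using order_iso_refl by blast

lemma pattern_le_length: "pattern_le \<sigma> \<pi> \<Longrightarrow> length \<sigma> \<le> length \<pi>"
  unfolding pattern_le_def order_iso_def by (metis list_emb_length)

lemma is_perm_nth_card:
  assumes "is_perm xs" "i < length xs"
  shows "xs ! i = Suc (card {j. j < length xs \<and> xs ! j < xs ! i})"
proof -
  have d: "distinct xs" and s: "set xs = {1..length xs}"
    using assms(1) by (auto simp: is_perm_def)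
  have b: "xs ! i \<in> {1..length xs}" using assms(2) s nth_mem by blast
  have inj: "inj_on ((!) xs) {j. j < length xs \<and> xs ! j < xs ! i}"
    using d by (auto simp: inj_on_def nth_eq_iff_index_eq)
  have "(!) xs ` {j. j < length xs \<and> xs ! j < xs ! i} = {v \<in> set xs. v < xs ! i}"
    by (auto simp: in_set_conv_nth)
  also have "\<dots> = {1..<xs ! i}" using s b by auto
  finally have "card {j. j < length xs \<and> xs ! j < xs ! i} = xs ! i - 1"
    using card_image[OF inj] by simp
  with b show ?thesis by auto
qed

lemma order_iso_perm_eq:
  assumes "is_perm xs" "is_perm ys" "order_iso xs ys"
  shows "xs = ys"
proof (rule nth_equalityI)
  show len: "length xs = length ys" using assms(3) by (simp add: order_iso_def)
  fix i assume i: "i < length xs"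
  have "{j. j < length xs \<and> xs ! j < xs ! i} = {j. j < length ys \<and> ys ! j < ys ! i}"
    using assms(3) i by (auto simp: order_iso_def)
  then show "xs ! i = ys ! i"
    using is_perm_nth_card[OF assms(1) i] is_perm_nth_card[OF assms(2), of i] i len by simp
qed

lemma pattern_less_length:
  assumes "is_perm \<sigma>" "is_perm \<pi>" "pattern_less \<sigma> \<pi>"
  shows "length \<sigma> < length \<pi>"
proof (rule ccontr)
  assume "\<not> length \<sigma> < length \<pi>"
  then have len: "length \<sigma> = length \<pi>"
    using assms(3) pattern_le_length[of \<sigma> \<pi>] by (simp add: pattern_less_def)
  obtain zs where "subseq zs \<pi>" "order_iso zs \<sigma>"
    using assms(3) by (auto simp: pattern_less_def pattern_le_def)
  moreover from this have "zs = \<pi>"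
    using len by (intro subseq_same_length) (auto simp: order_iso_def)
  ultimately have "\<pi> = \<sigma>" using order_iso_perm_eq assms(1,2) by blast
  with assms(3) show False by (simp add: pattern_less_def)
qed

text \<open>Lists that are not permutations get the junk value 0.\<close>

function mobius :: "nat list \<Rightarrow> nat list \<Rightarrow> int" where
  "mobius \<sigma> \<pi> =
     (if \<not> (is_perm \<sigma> \<and> is_perm \<pi>) then 0
      else if \<sigma> = \<pi> then 1
      else if \<not> pattern_le \<sigma> \<pi> then 0
      else - (\<Sum>\<tau> \<in> {\<tau>. is_perm \<tau> \<and> pattern_le \<sigma> \<tau> \<and> pattern_less \<tau> \<pi>}. mobius \<sigma> \<tau>))"
  by pat_completeness auto
termination
  by (relation "measure (\<lambda>(\<sigma>, \<pi>). length \<pi>)") (auto intro: pattern_less_length)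

declare mobius.simps [simp del]

lemma finite_interval:
  "finite {\<tau>. is_perm \<tau> \<and> pattern_le \<sigma> \<tau> \<and> pattern_less \<tau> \<pi>}"
proof (rule finite_subset)
  show "{\<tau>. is_perm \<tau> \<and> pattern_le \<sigma> \<tau> \<and> pattern_less \<tau> \<pi>}
      \<subseteq> {xs. set xs \<subseteq> {1..length \<pi>} \<and> length xs \<le> length \<pi>}"
    using pattern_le_length by (fastforce simp: is_perm_def pattern_less_def)
  show "finite {xs. set xs \<subseteq> {1..length \<pi>} \<and> length xs \<le> length \<pi>}"
    by (rule finite_lists_length_le) simp
qed

lemma mobius_refl: "is_perm \<sigma> \<Longrightarrow> mobius \<sigma> \<sigma> = 1"
  by (simp add: mobius.simps)

lemma mobius_not_le: "\<not> pattern_le \<sigma> \<pi> \<Longrightarrow> mobius \<sigma> \<pi> = 0"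
  using pattern_le_refl by (auto simp: mobius.simps)

lemma mobius_less:
  assumes "is_perm \<sigma>" "is_perm \<pi>" "pattern_less \<sigma> \<pi>"
  shows "mobius \<sigma> \<pi> =
    - (\<Sum>\<tau> \<in> {\<tau>. is_perm \<tau> \<and> pattern_le \<sigma> \<tau> \<and> pattern_less \<tau> \<pi>}. mobius \<sigma> \<tau>)"
  using assms by (subst mobius.simps) (simp add: pattern_less_def)

definition direct_sum :: "nat list \<Rightarrow> nat list \<Rightarrow> nat list" where
  "direct_sum \<alpha> \<beta> = \<alpha> @ map (\<lambda>b. b + length \<alpha>) \<beta>"

lemma direct_sum_assoc:
  "direct_sum (direct_sum \<alpha> \<beta>) \<gamma> = direct_sum \<alpha> (direct_sum \<beta> \<gamma>)"
  by (simp add: direct_sum_def o_def ac_simps)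

definition has_interval_copy :: "nat list \<Rightarrow> nat list \<Rightarrow> bool" where
  "has_interval_copy \<pi> \<phi> \<longleftrightarrow>
     (\<exists>ws. sublist ws \<pi> \<and> (\<exists>a. set ws = {a..<a + length ws}) \<and> order_iso ws \<phi>)"

definition annihilator :: "nat list \<Rightarrow> bool" where
  "annihilator \<phi> \<longleftrightarrow> is_perm \<phi> \<and>
     (\<forall>\<pi>. is_perm \<pi> \<and> has_interval_copy \<pi> \<phi> \<longrightarrow> mobius [1] \<pi> = 0)"

end

theory Submission
  imports Defs
begin

text \<open>
  Suppose that \<open>\<pi>\<close> contains an interval \<open>A @ c # B\<close> with \<open>A\<close>, \<open>B\<close> non-empty and
  \<open>A < c < B\<close>, as an interval copy of \<open>\<alpha> \<oplus> 1 \<oplus> \<beta>\<close> does. Delete the centre \<open>c\<close> and call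
  the result \<open>\<pi>'\<close>. The key point is a dichotomy for a permutation \<open>\<tau> < \<pi>\<close>. If an
  occurrence of \<open>\<tau>\<close> in \<open>\<pi>\<close> uses \<open>c\<close> together with entries of both \<open>A\<close> and \<open>B\<close>, then \<open>\<tau>\<close>
  again has an interval of the same kind, so that \<open>\<mu>[1,\<tau>] = 0\<close> by induction on the length.
  Otherwise \<open>\<tau> \<le> \<pi>'\<close>: an occurrence that uses \<open>c\<close> but misses \<open>A\<close> (or \<open>B\<close>) stays an
  occurrence of \<open>\<tau>\<close> when \<open>c\<close> is exchanged for an entry of \<open>A\<close> (or \<open>B\<close>), since no entry
  outside the interval can tell the two apart. This is \<open>occurrence_dichotomy\<close>.

  Hence the sum of \<open>\<mu>[1,\<tau>]\<close> over \<open>\<tau> < \<pi>\<close> equals the sum over \<open>\<tau> \<le> \<pi>'\<close>, and the latter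
  is zero because \<open>1 < \<pi>'\<close>. The argument does not fix \<open>\<alpha>\<close> and \<open>\<beta>\<close>, and it must not:
  the interval inherited by \<open>\<tau>\<close> can be an interval copy of \<open>\<alpha>' \<oplus> 1 \<oplus> \<beta>'\<close> for smaller
  \<open>\<alpha>'\<close> and \<open>\<beta>'\<close>.
\<close>

section \<open>Standardisation\<close>

lemma subseq_mapE:
  assumes "subseq zs (map f xs)"
  obtains ys where "zs = map f ys" "subseq ys xs"
  using assms by (auto simp: subseq_conv_nths nths_map)

lemma set_mono_subseq: "subseq xs ys \<Longrightarrow> set xs \<subseteq> set ys"
  using set_nths_subset by (metis subseq_conv_nths)

lemma distinct_subseq: "subseq xs ys \<Longrightarrow> distinct ys \<Longrightarrow> distinct xs"
  by (metis distinct_nthsI subseq_conv_nths)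

lemma order_iso_sym: "order_iso xs ys \<Longrightarrow> order_iso ys xs"
  by (auto simp: order_iso_def)

lemma order_iso_trans: "order_iso xs ys \<Longrightarrow> order_iso ys zs \<Longrightarrow> order_iso xs zs"
  by (auto simp: order_iso_def)

lemma order_iso_map:
  assumes "strict_mono_on (set xs) f"
  shows "order_iso (map f xs) xs"
  using assms by (auto simp: order_iso_def strict_mono_on_less)

lemma pattern_le_map_iff:
  assumes "strict_mono_on (set xs) f"
  shows "pattern_le \<sigma> (map f xs) \<longleftrightarrow> pattern_le \<sigma> xs"
proof -
  have iso: "order_iso (map f ys) ys" if "subseq ys xs" for ys
    using monotone_on_subset[OF assms set_mono_subseq[OF that]] by (rule order_iso_map)
  show ?thesis
  proof
    assume "pattern_le \<sigma> (map f xs)"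
    then obtain zs where "subseq zs (map f xs)" "order_iso zs \<sigma>"
      by (auto simp: pattern_le_def)
    then obtain ys where "subseq ys xs" "order_iso (map f ys) \<sigma>"
      by (auto elim: subseq_mapE)
    then show "pattern_le \<sigma> xs"
      using order_iso_trans[OF order_iso_sym[OF iso]] by (auto simp: pattern_le_def)
  next
    assume "pattern_le \<sigma> xs"
    then obtain ys where "subseq ys xs" "order_iso ys \<sigma>"
      by (auto simp: pattern_le_def)
    then show "pattern_le \<sigma> (map f xs)"
      using order_iso_trans[OF iso] subseq_map unfolding pattern_le_def by blast
  qed
qed

definition rank_in :: "nat list \<Rightarrow> nat \<Rightarrow> nat" where
  "rank_in xs x = Suc (card {y \<in> set xs. y < x})"

definition standardise :: "nat list \<Rightarrow> nat list" where
  "standardise xs = map (rank_in xs) xs"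

lemma strict_mono_on_rank_in: "strict_mono_on (set xs) (rank_in xs)"
proof (rule strict_mono_onI)
  fix x y assume "x \<in> set xs" "y \<in> set xs" "x < y"
  then have "{z \<in> set xs. z < x} \<subset> {z \<in> set xs. z < y}" by auto
  then show "rank_in xs x < rank_in xs y"
    by (simp add: rank_in_def psubset_card_mono)
qed

lemma is_perm_standardise:
  assumes "distinct xs"
  shows "is_perm (standardise xs)"
proof -
  have inj: "inj_on (rank_in xs) (set xs)"
    using strict_mono_on_rank_in by (rule strict_mono_on_imp_inj_on)
  have "rank_in xs x \<in> {1..length xs}" if "x \<in> set xs" for x
  proof -
    have "{y \<in> set xs. y < x} \<subset> set xs" using that by auto
    then have "card {y \<in> set xs. y < x} < card (set xs)"
      by (simp add: psubset_card_mono)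
    then show ?thesis using card_length[of xs] by (simp add: rank_in_def)
  qed
  then have "rank_in xs ` set xs \<subseteq> {1..length xs}" by blast
  moreover have "card (rank_in xs ` set xs) = length xs"
    using assms inj by (simp add: card_image distinct_card)
  ultimately have "rank_in xs ` set xs = {1..length xs}"
    by (intro card_subset_eq) auto
  then show ?thesis
    using assms inj by (simp add: is_perm_def standardise_def distinct_map)
qed

lemma order_iso_perm_eq_standardise:
  assumes "distinct xs" "is_perm \<sigma>" "order_iso xs \<sigma>"
  shows "\<sigma> = standardise xs"
proof (rule order_iso_perm_eq)
  have "order_iso xs (standardise xs)"
    unfolding standardise_def
    by (intro order_iso_sym[OF order_iso_map] strict_mono_on_rank_in)
  then show "order_iso \<sigma> (standardise xs)"
    using order_iso_trans[OF order_iso_sym[OF assms(3)]] by blast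
qed (use assms is_perm_standardise in auto)

lemma pattern_le_standardise_iff: "pattern_le \<sigma> (standardise xs) \<longleftrightarrow> pattern_le \<sigma> xs"
  unfolding standardise_def using strict_mono_on_rank_in by (rule pattern_le_map_iff)

section \<open>Intervals with a centre\<close>

text \<open>Intervals are described here by order alone: an entry outside the block lies below all
  of the block or above all of it. Unlike contiguity of the set of values, this passes to
  subsequences without standardising them first.\<close>

definition centred_interval ::
    "nat list \<Rightarrow> nat list \<Rightarrow> nat \<Rightarrow> nat list \<Rightarrow> nat list \<Rightarrow> bool" where
  "centred_interval P A c B S \<longleftrightarrow>
     A \<noteq> [] \<and> B \<noteq> [] \<and> (\<forall>x\<in>set A. x < c) \<and> (\<forall>y\<in>set B. c < y) \<and>
     (\<forall>z\<in>set P \<union> set S. (\<forall>w\<in>set (A @ c # B). z < w) \<or> (\<forall>w\<in>set (A @ c # B). w < z))"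

definition has_centred_interval :: "nat list \<Rightarrow> bool" where
  "has_centred_interval xs \<longleftrightarrow>
     (\<exists>P A c B S. xs = P @ A @ c # B @ S \<and> centred_interval P A c B S)"

lemma has_centred_interval_map:
  assumes "strict_mono_on (set xs) f" "has_centred_interval xs"
  shows "has_centred_interval (map f xs)"
proof -
  obtain P A c B S where xs: "xs = P @ A @ c # B @ S" and ci: "centred_interval P A c B S"
    using assms(2) by (auto simp: has_centred_interval_def)
  have mono: "f x < f y" if "x \<in> set xs" "y \<in> set xs" "x < y" for x y
    using assms(1) that by (rule strict_mono_onD)
  have "centred_interval (map f P) (map f A) (f c) (map f B) (map f S)"
    unfolding centred_interval_def
  proof (intro conjI ballI)
    fix z assume "z \<in> set (map f P) \<union> set (map f S)"
    then obtain z' where z': "z = f z'" "z' \<in> set P \<union> set S" by auto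
    then consider "\<forall>w\<in>set (A @ c # B). z' < w" | "\<forall>w\<in>set (A @ c # B). w < z'"
      using ci by (auto simp: centred_interval_def)
    then show "(\<forall>w\<in>set (map f A @ f c # map f B). z < w) \<or>
        (\<forall>w\<in>set (map f A @ f c # map f B). w < z)"
    proof cases
      case 1
      then have "\<forall>w\<in>set (map f A @ f c # map f B). z < w"
        using z' mono by (auto simp: xs)
      then show ?thesis ..
    next
      case 2
      then have "\<forall>w\<in>set (map f A @ f c # map f B). w < z"
        using z' mono by (auto simp: xs)
      then show ?thesis ..
    qed
  qed (use ci mono in \<open>auto simp: centred_interval_def xs\<close>)
  then show ?thesis
    unfolding has_centred_interval_def xs by (metis list.simps(9) map_append)
qed

text \<open>Deleting the centre loses no occurrence that misses one of the two sides: the centre can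
  be exchanged for an entry of that side, which has the same position and the same order
  relative to all other entries used.\<close>

lemma occurrence_dichotomy:
  assumes ci: "centred_interval P A c B S"
    and dist: "distinct (P @ A @ c # B @ S)"
    and sub: "subseq zs (P @ A @ c # B @ S)"
  shows "has_centred_interval zs \<or> pattern_le zs (P @ A @ B @ S)"
proof -
  obtain P' A' C' B' S' where zs: "zs = P' @ A' @ C' @ B' @ S'"
    and subs: "subseq P' P" "subseq A' A" "subseq C' [c]" "subseq B' B" "subseq S' S"
  proof -
    have "subseq zs (P @ A @ [c] @ B @ S)" using sub by simp
    then show ?thesis
      by (elim subseq_appendE) (auto intro: that)
  qed
  have sets: "set P' \<subseteq> set P" "set A' \<subseteq> set A" "set B' \<subseteq> set B" "set S' \<subseteq> set S"
    using subs by (simp_all add: set_mono_subseq)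
  have C': "C' = [] \<or> C' = [c]"
    using subs(3) by (cases C') (auto simp: subseq_Cons' split: if_splits)
  have exchange: "order_iso (P' @ A' @ b # B' @ S') zs"
    if C: "C' = [c]" and b: "b \<in> set A \<union> set B"
      and inner: "\<And>x. x \<in> set A' \<Longrightarrow> x < b" "\<And>x. x \<in> set B' \<Longrightarrow> b < x" for b
  proof -
    let ?f = "id(c := b)"
    have outer: "x < c \<and> x < b \<or> c < x \<and> b < x" if "x \<in> set P \<union> set S" for x
    proof -
      have "(\<forall>w\<in>set (A @ c # B). x < w) \<or> (\<forall>w\<in>set (A @ c # B). w < x)"
        using ci that by (simp add: centred_interval_def)
      then show ?thesis using b by auto
    qed
    have "(x < c \<longrightarrow> x < b) \<and> (c < x \<longrightarrow> b < x)" if x: "x \<in> set zs" for x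
    proof -
      consider "x \<in> set P \<union> set S" | "x \<in> set A'" | "x \<in> set B'" | "x = c"
        using x sets by (auto simp: zs C)
      then show ?thesis
      proof cases
        case 1
        then show ?thesis using outer[of x] by auto
      next
        case 2
        then have "x < c" using ci sets by (auto simp: centred_interval_def)
        then show ?thesis using 2 inner by simp
      next
        case 3
        then have "c < x" using ci sets by (auto simp: centred_interval_def)
        then show ?thesis using 3 inner by simp
      qed simp
    qed
    \<comment> \<open>So \<open>b\<close> and \<open>c\<close> compare alike with every entry of \<open>zs\<close> other than \<open>c\<close>.\<close>
    then have "strict_mono_on (set zs) ?f" by (auto simp: strict_mono_on_def)
    then have "order_iso (map ?f zs) zs" by (rule order_iso_map)
    moreover have "c \<notin> set P' \<union> set A' \<union> set B' \<union> set S'" using dist sets by auto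
    then have "map ?f zs = P' @ A' @ b # B' @ S'"
      by (auto simp: zs C intro!: map_idI)
    ultimately show ?thesis by simp
  qed
  consider "C' = []" | "C' = [c]" "A' = []" | "C' = [c]" "B' = []"
    | "C' = [c]" "A' \<noteq> []" "B' \<noteq> []"
    using C' by blast
  then show ?thesis
  proof cases
    case 1
    then have "subseq zs (P @ A @ B @ S)"
      using subs by (auto simp: zs intro!: list_emb_append_mono)
    then show ?thesis using order_iso_refl by (auto simp: pattern_le_def)
  next
    case 2
    obtain a where a: "a \<in> set A" using ci by (cases A) (auto simp: centred_interval_def)
    have a_less: "a < x" if "x \<in> set B'" for x
    proof -
      have "a < c" "c < x" using ci a sets that by (auto simp: centred_interval_def)
      then show ?thesis by (rule less_trans)
    qed
    have "order_iso (P' @ A' @ a # B' @ S') zs"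
      using a 2 a_less by (intro exchange) auto
    moreover have "subseq (P' @ [a] @ B' @ S') (P @ A @ B @ S)"
      using subs a by (intro list_emb_append_mono) (simp_all add: subseq_singleton_left)
    ultimately show ?thesis using 2 by (auto simp: pattern_le_def)
  next
    case 3
    obtain b where b: "b \<in> set B" using ci by (cases B) (auto simp: centred_interval_def)
    have less_b: "x < b" if "x \<in> set A'" for x
    proof -
      have "x < c" "c < b" using ci b sets that by (auto simp: centred_interval_def)
      then show ?thesis by (rule less_trans)
    qed
    have "order_iso (P' @ A' @ b # B' @ S') zs"
      using b 3 less_b by (intro exchange) auto
    moreover have "subseq (P' @ A' @ [b] @ S') (P @ A @ B @ S)"
      using subs b by (intro list_emb_append_mono) (simp_all add: subseq_singleton_left)
    ultimately show ?thesis using 3 by (auto simp: pattern_le_def)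
  next
    case 4
    have "(\<forall>w\<in>set (A' @ c # B'). z < w) \<or> (\<forall>w\<in>set (A' @ c # B'). w < z)"
      if "z \<in> set P' \<union> set S'" for z
    proof -
      have "z \<in> set P \<union> set S" using that sets by auto
      then have "(\<forall>w\<in>set (A @ c # B). z < w) \<or> (\<forall>w\<in>set (A @ c # B). w < z)"
        using ci by (simp add: centred_interval_def)
      moreover have "set (A' @ c # B') \<subseteq> set (A @ c # B)" using sets by auto
      ultimately show ?thesis by blast
    qed
    moreover have "\<forall>x\<in>set A'. x < c" "\<forall>y\<in>set B'. c < y"
      using ci sets by (auto simp: centred_interval_def)
    ultimately have "centred_interval P' A' c B' S'"
      using 4 by (simp add: centred_interval_def)
    moreover have "zs = P' @ A' @ c # B' @ S'" using 4 zs by simp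
    ultimately show ?thesis unfolding has_centred_interval_def by blast
  qed
qed

section \<open>Vanishing of the principal Moebius function\<close>

lemma pattern_le_cong_order_iso: "order_iso \<sigma> \<tau> \<Longrightarrow> pattern_le \<sigma> \<pi> \<longleftrightarrow> pattern_le \<tau> \<pi>"
  unfolding pattern_le_def using order_iso_sym order_iso_trans by blast

lemma sum_mobius_ideal_eq_0:
  assumes "is_perm \<sigma>" "is_perm \<pi>" "pattern_less \<sigma> \<pi>"
  shows "(\<Sum>\<tau> \<in> {\<tau>. is_perm \<tau> \<and> pattern_le \<sigma> \<tau> \<and> pattern_le \<tau> \<pi>}. mobius \<sigma> \<tau>) = 0"
proof -
  have "{\<tau>. is_perm \<tau> \<and> pattern_le \<sigma> \<tau> \<and> pattern_le \<tau> \<pi>} =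
      insert \<pi> {\<tau>. is_perm \<tau> \<and> pattern_le \<sigma> \<tau> \<and> pattern_less \<tau> \<pi>}"
    using assms pattern_le_refl by (auto simp: pattern_less_def)
  then show ?thesis
    using mobius_less[OF assms] finite_interval[of \<sigma> \<pi>] by (simp add: pattern_less_def)
qed

text \<open>The half-open interval \<open>[\<sigma>,\<pi>)\<close> may be cut down to the closed interval \<open>[\<sigma>,\<pi>']\<close>, on
  which the Moebius values cancel, once every \<open>\<tau> < \<pi>\<close> outside it has value zero.\<close>

lemma mobius_eq_0_if_support_below:
  assumes "is_perm \<sigma>" "is_perm \<pi>" "is_perm \<pi>'"
    and "pattern_less \<sigma> \<pi>" "pattern_less \<sigma> \<pi>'"
    and below: "\<And>\<tau>. pattern_le \<tau> \<pi>' \<Longrightarrow> pattern_less \<tau> \<pi>"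
    and support: "\<And>\<tau>. is_perm \<tau> \<Longrightarrow> pattern_less \<tau> \<pi> \<Longrightarrow> \<not> pattern_le \<tau> \<pi>' \<Longrightarrow> mobius \<sigma> \<tau> = 0"
  shows "mobius \<sigma> \<pi> = 0"
proof -
  have "(\<Sum>\<tau> \<in> {\<tau>. is_perm \<tau> \<and> pattern_le \<sigma> \<tau> \<and> pattern_less \<tau> \<pi>}. mobius \<sigma> \<tau>)
      = (\<Sum>\<tau> \<in> {\<tau>. is_perm \<tau> \<and> pattern_le \<sigma> \<tau> \<and> pattern_le \<tau> \<pi>'}. mobius \<sigma> \<tau>)"
    using below support by (intro sum.mono_neutral_right finite_interval) auto
  then show ?thesis
    using sum_mobius_ideal_eq_0[OF assms(1,3,5)] mobius_less[OF assms(1,2,4)] by simp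
qed

lemma one_pattern_less:
  assumes "2 \<le> length xs"
  shows "pattern_less [1] xs"
proof -
  have "subseq [hd xs] xs" using assms by (cases xs) auto
  moreover have "order_iso [hd xs] [1]" by (simp add: order_iso_def)
  ultimately show ?thesis using assms by (auto simp: pattern_less_def pattern_le_def)
qed

text \<open>The permutation below \<open>\<pi>\<close> to which the sum is cut down is \<open>\<pi>\<close> without its centre; as
  both sides are non-empty, it still has length at least two and lies strictly above
  \<open>1\<close>.\<close>

theorem mobius_one_eq_0_if_has_centred_interval:
  assumes "is_perm \<pi>" "has_centred_interval \<pi>"
  shows "mobius [1] \<pi> = 0"
  using assms
proof (induction \<pi> rule: length_induct)
  case (1 \<pi>)
  obtain P A c B S where \<pi>: "\<pi> = P @ A @ c # B @ S" and ci: "centred_interval P A c B S"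
    using 1 by (auto simp: has_centred_interval_def)
  have dist: "distinct \<pi>" using 1 by (simp add: is_perm_def)
  define \<pi>' where "\<pi>' = standardise (P @ A @ B @ S)"
  have le_iff: "pattern_le \<tau> \<pi>' \<longleftrightarrow> pattern_le \<tau> (P @ A @ B @ S)" for \<tau>
    by (simp add: \<pi>'_def pattern_le_standardise_iff)
  have long: "2 \<le> length \<pi>'" "length \<pi>' < length \<pi>"
    using ci by (auto simp: \<pi> \<pi>'_def standardise_def centred_interval_def
        Suc_le_eq neq_Nil_conv)
  have sub: "subseq (P @ A @ B @ S) \<pi>"
    by (auto simp: \<pi> intro!: list_emb_append_mono)
  show ?case
  proof (rule mobius_eq_0_if_support_below[where \<pi>' = \<pi>'])
    show "is_perm \<pi>'"
      using dist by (auto simp: \<pi>'_def \<pi> intro!: is_perm_standardise)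
    show "pattern_less [1] \<pi>'" "pattern_less [1] \<pi>"
      using long by (intro one_pattern_less; simp)+
  next
    fix \<tau> assume "pattern_le \<tau> \<pi>'"
    then obtain zs where "subseq zs (P @ A @ B @ S)" "order_iso zs \<tau>"
      unfolding le_iff by (auto simp: pattern_le_def)
    then have "pattern_le \<tau> \<pi>"
      using subseq_order.trans[OF _ sub] by (auto simp: pattern_le_def)
    moreover have "length \<tau> < length \<pi>"
      using pattern_le_length[OF \<open>pattern_le \<tau> \<pi>'\<close>] long by simp
    ultimately show "pattern_less \<tau> \<pi>" by (auto simp: pattern_less_def)
  next
    fix \<tau> assume \<tau>: "is_perm \<tau>" "pattern_less \<tau> \<pi>" "\<not> pattern_le \<tau> \<pi>'"
    then obtain zs where zs: "subseq zs \<pi>" "order_iso zs \<tau>"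
      by (auto simp: pattern_less_def pattern_le_def)
    have "has_centred_interval zs"
      using occurrence_dichotomy[OF ci, of zs] dist zs \<tau>(3) pattern_le_cong_order_iso
      unfolding le_iff \<pi> by blast
    moreover have "\<tau> = standardise zs"
      using zs \<tau>(1) dist distinct_subseq order_iso_perm_eq_standardise by blast
    ultimately have "has_centred_interval \<tau>"
      by (simp add: standardise_def has_centred_interval_map strict_mono_on_rank_in)
    then show "mobius [1] \<tau> = 0"
      using "1.IH" \<tau> "1.prems"(1) pattern_less_length by blast
  qed (use "1.prems" in \<open>simp_all add: is_perm_def\<close>)
qed

section \<open>Interval copies of \<open>\<alpha> \<oplus> 1 \<oplus> \<beta>\<close>\<close>

lemma is_perm_direct_sum:
  assumes "is_perm \<alpha>" "is_perm \<beta>"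
  shows "is_perm (direct_sum \<alpha> \<beta>)"
proof -
  have "set (map (\<lambda>b. b + length \<alpha>) \<beta>) = {length \<alpha> + 1..length \<alpha> + length \<beta>}"
    using assms image_add_atLeastAtMost'[of "length \<alpha>" 1 "length \<beta>"]
    by (simp add: is_perm_def add.commute)
  then show ?thesis
    using assms by (auto simp: is_perm_def direct_sum_def distinct_map)
qed

text \<open>An entry outside a block cannot take a value strictly between two values of the block, as
  these are contiguous and \<open>\<pi>\<close> is injective. The sides and the centre are read off from
  \<open>\<alpha> \<oplus> 1 \<oplus> \<beta>\<close> because the copy and its pattern differ by a strictly increasing map.\<close>

lemma has_centred_interval_if_interval_copy:
  assumes perms: "is_perm \<alpha>" "is_perm \<beta>" and nonempty: "\<alpha> \<noteq> []" "\<beta> \<noteq> []"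
    and \<pi>: "is_perm \<pi>" "has_interval_copy \<pi> (direct_sum (direct_sum \<alpha> [1]) \<beta>)"
  shows "has_centred_interval \<pi>"
proof -
  let ?\<phi> = "direct_sum (direct_sum \<alpha> [1]) \<beta>"
  obtain P ws S a where ws: "\<pi> = P @ ws @ S" "set ws = {a..<a + length ws}"
      "order_iso ws ?\<phi>"
    using \<pi>(2) by (auto simp: has_interval_copy_def sublist_def)
  have dist: "distinct (P @ ws @ S)" using \<pi>(1) ws(1) by (simp add: is_perm_def)
  have "is_perm ?\<phi>"
    using perms by (intro is_perm_direct_sum) (auto simp: is_perm_def)
  then have "?\<phi> = map (rank_in ws) ws"
    using order_iso_perm_eq_standardise ws(3) dist by (simp add: standardise_def)
  then have "map (rank_in ws) ws =
      \<alpha> @ Suc (length \<alpha>) # map (\<lambda>b. b + Suc (length \<alpha>)) \<beta>"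
    by (simp add: direct_sum_def)
  then obtain A c B where ABC: "ws = A @ c # B" "map (rank_in ws) A = \<alpha>"
      "rank_in ws c = Suc (length \<alpha>)" "map (rank_in ws) B = map (\<lambda>b. b + Suc (length \<alpha>)) \<beta>"
    by (auto simp: map_eq_append_conv map_eq_Cons_conv)
  have less_iff: "x < y \<longleftrightarrow> rank_in ws x < rank_in ws y" if "x \<in> set ws" "y \<in> set ws" for x y
    using strict_mono_on_less[OF strict_mono_on_rank_in that] by simp
  have "x < c" if "x \<in> set A" for x
  proof -
    have "rank_in ws x \<in> set \<alpha>" using that ABC(2) by auto
    then have "rank_in ws x < rank_in ws c" using perms(1) ABC(3) by (auto simp: is_perm_def)
    then show ?thesis using less_iff[of x c] that ABC(1) by simp
  qed
  moreover have "c < y" if "y \<in> set B" for y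
  proof -
    have "rank_in ws y \<in> set (map (\<lambda>b. b + Suc (length \<alpha>)) \<beta>)"
      using that ABC(4) by (metis imageI set_map)
    then have "rank_in ws c < rank_in ws y" using perms(2) ABC(3) by (auto simp: is_perm_def)
    then show ?thesis using less_iff[of c y] that ABC(1) by simp
  qed
  moreover have "(\<forall>w\<in>set ws. z < w) \<or> (\<forall>w\<in>set ws. w < z)" if "z \<in> set P \<union> set S" for z
  proof -
    have "z \<notin> set ws" using that dist by auto
    then have "z < a \<or> a + length ws \<le> z" unfolding ws(2) by auto
    then show ?thesis unfolding ws(2) by auto
  qed
  moreover have "A \<noteq> []" "B \<noteq> []" using ABC(2,4) nonempty by auto
  ultimately have "centred_interval P A c B S"
    by (simp add: centred_interval_def ABC(1))
  then show ?thesis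
    unfolding has_centred_interval_def ws(1) ABC(1) by (metis append.assoc append_Cons)
qed

theorem corollary34:
  fixes \<alpha> \<beta> :: "nat list"
  assumes "is_perm \<alpha>" "\<alpha> \<noteq> []"
    and "is_perm \<beta>" "\<beta> \<noteq> []"
  shows "annihilator (direct_sum (direct_sum \<alpha> [1]) \<beta>)"
  unfolding annihilator_def
proof (intro conjI allI impI)
  show "is_perm (direct_sum (direct_sum \<alpha> [1]) \<beta>)"
    using assms by (intro is_perm_direct_sum) (auto simp: is_perm_def)
next
  fix \<pi> assume "is_perm \<pi> \<and> has_interval_copy \<pi> (direct_sum (direct_sum \<alpha> [1]) \<beta>)"
  then show "mobius [1] \<pi> = 0"
    using assms by (blast intro: mobius_one_eq_0_if_has_centred_interval
        has_centred_interval_if_interval_copy)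
qed

end
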